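(* Let $f:\mathbb R\to[0,\infty)$ be defined by $f(x)=x^2/2$ for $x\in[-1,1]$ and $f(x)=|x|-1/2$ for $|x|>1$. Let $(B_k)_{k>0}$ be a sequence of events in a probability space $(\Omega,\mathcal T,\mathbb P)$ such that $\mathbb P(B_1)>0$ and $\sum_{k>0}\mathbb P(B_k)=\infty$. (i) Suppose that there exists a triangular array $(g_{j,n})_{1\le j\le n}$ of non-negative measurable functions (random variables) on $\Omega$ such that $g_{j,n}\le\mathbf 1_{B_j}$ for every $j\in[1,n]$ and such that, with $\tilde S_n=\sum_{k=1}^ng_{k,n}$ and $\tilde E_n=\mathbb E(\tilde S_n)$, there exists an increasing sequence $(n_k)_k$ of positive integers with $$\lim_{k\to\infty}\tilde E_{n_k}=\infty\quad\text{and}\quad\lim_{k\to\infty}\mathbb E\Bigl(f\bigl((\tilde S_{n_k}-\tilde E_{n_k})/\tilde E_{n_k}\bigr)\Bigr)=0.$$ Then $(B_k)_{k>0}$ is a Borel-Cantelli sequence. (ii) Let $S_n=\sum_{k=1}^n\mathbf 1_{B_k}$ and $E_n=\mathbb E(S_n)$. If $\lim_{n\to\infty}\mathbb E\bigl(f((S_n-E_n)/E_n)\bigr)=0$, then $(B_k)_{k>0}$ is an $L^1$ Borel-Cantelli sequence. (iii) With the same $S_n$ and $E_n$, if $$\sum_{n>0}\frac{\mathbb P(B_n)}{E_n}\sup_{k\in[1,n]}\mathbb E\bigl(f((S_k-E_k)/E_n)\bigr)<\infty,$$ then $(B_k)_{k>0}$ is a strongly Borel-Cantelli sequence.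
   Context: With $S_n=\sum_{k=1}^n\mathbf 1_{B_k}$ and $E_n=\mathbb E(S_n)$: $(B_k)_{k>0}$ is a Borel-Cantelli sequence if $\mathbb P(\limsup_kB_k)=1$, i.e. $\sum_k\mathbf 1_{B_k}=\infty$ a.s.; it is an $L^1$ Borel-Cantelli sequence if $\sum_k\mathbb P(B_k)=\infty$ and $\lim_n\|S_n/E_n-1\|_1=0$; it is a strongly Borel-Cantelli sequence if $\sum_k\mathbb P(B_k)=\infty$ and $\lim_nS_n/E_n=1$ a.s. *)

theory Defs
  imports "HOL-Probability.Probability"
begin

definition huber :: "real \<Rightarrow> real" where
  "huber x = (if x \<in> {-1..1} then x\<^sup>2 / 2 else \<bar>x\<bar> - 1 / 2)"

text \<open>Sequences of events \<open>(B\<^sub>k)\<close> are indexed by \<open>k > 0\<close>; the value \<open>B 0\<close> is a dummy on which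
  none of the notions below depends.\<close>

definition event_count :: "(nat \<Rightarrow> 'a set) \<Rightarrow> nat \<Rightarrow> 'a \<Rightarrow> real" where
  "event_count B n \<omega> = (\<Sum>k=1..n. indicator (B k) \<omega>)"

definition mean_count :: "'a measure \<Rightarrow> (nat \<Rightarrow> 'a set) \<Rightarrow> nat \<Rightarrow> real" where
  "mean_count M B n = (\<integral>\<omega>. event_count B n \<omega> \<partial>M)"

definition array_sum :: "(nat \<Rightarrow> nat \<Rightarrow> 'a \<Rightarrow> real) \<Rightarrow> nat \<Rightarrow> 'a \<Rightarrow> real" where
  "array_sum g n \<omega> = (\<Sum>k=1..n. g k n \<omega>)"

definition mean_array_sum :: "'a measure \<Rightarrow> (nat \<Rightarrow> nat \<Rightarrow> 'a \<Rightarrow> real) \<Rightarrow> nat \<Rightarrow> real" where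
  "mean_array_sum M g n = (\<integral>\<omega>. array_sum g n \<omega> \<partial>M)"

definition divergent_probs :: "'a measure \<Rightarrow> (nat \<Rightarrow> 'a set) \<Rightarrow> bool" where
  "divergent_probs M B \<longleftrightarrow> (\<Sum>k. emeasure M (B (Suc k))) = \<infinity>"

definition borel_cantelli_seq :: "'a measure \<Rightarrow> (nat \<Rightarrow> 'a set) \<Rightarrow> bool" where
  "borel_cantelli_seq M B \<longleftrightarrow> measure M (limsup B) = 1"

text \<open>In the next two definitions the finitely many terms with \<open>E\<^sub>n = 0\<close>, where the division is
  meaningless, do not affect the limits.\<close>

definition L1_borel_cantelli_seq :: "'a measure \<Rightarrow> (nat \<Rightarrow> 'a set) \<Rightarrow> bool" where
  "L1_borel_cantelli_seq M B \<longleftrightarrow> divergent_probs M B \<and>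
     (\<lambda>n. \<integral>\<omega>. \<bar>event_count B n \<omega> / mean_count M B n - 1\<bar> \<partial>M) \<longlonglongrightarrow> 0"

definition strongly_borel_cantelli_seq :: "'a measure \<Rightarrow> (nat \<Rightarrow> 'a set) \<Rightarrow> bool" where
  "strongly_borel_cantelli_seq M B \<longleftrightarrow> divergent_probs M B \<and>
     (AE \<omega> in M. (\<lambda>n. event_count B n \<omega> / mean_count M B n) \<longlonglongrightarrow> 1)"

end

theory Submission
  imports Defs
begin

text \<open>Write \<open>Y\<^sub>n = S\<^sub>n / E\<^sub>n - 1\<close>.
  (i) If \<open>limsup B\<close> did not have full measure, the counts would be bounded on an event of positive
  probability, where the normalised deviation of the array sums would end up below \<open>-1/2\<close>; this
  bounds the Huber means away from zero.
  (ii) The tangent bound \<open>\<epsilon>\<bar>x\<bar> - \<epsilon>\<^sup>2/2 \<le> f x\<close> converts convergence of the Huber means into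
  \<open>L\<^sup>1\<close> convergence.
  (iii) Taking \<open>k = n\<close> in the supremum gives \<open>\<Sum>n. P(B\<^sub>n) / E\<^sub>n * f(Y\<^sub>n) < \<infinity>\<close> almost surely. The rest is
  pathwise: since \<open>S\<close> and \<open>E\<close> are monotone, a value \<open>\<bar>Y\<^sub>n\<bar> \<ge> 4\<epsilon>\<close> forces
  \<open>\<bar>Y\<^sub>m\<bar> \<ge> \<epsilon>\<close> on a whole block of indices over which \<open>E\<close> grows by a fixed factor, and such a
  block contributes at least a fixed amount to the series.\<close>

section \<open>Elementary bounds for the Huber function\<close>

lemma huber_nonneg: "0 \<le> huber x"
  by (auto simp: huber_def abs_if)

lemma huber_le_abs: "huber x \<le> \<bar>x\<bar>"
proof (cases "\<bar>x\<bar> \<le> 1")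
  case True
  then have "x\<^sup>2 \<le> \<bar>x\<bar>"
    using mult_left_le[of "\<bar>x\<bar>" "\<bar>x\<bar>"] by (simp add: power2_eq_square)
  then show ?thesis
    using True by (auto simp: huber_def)
qed (auto simp: huber_def)

text \<open>As a function of \<open>\<bar>x\<bar>\<close>, the left side is the tangent to the
  convex function \<open>huber\<close> at \<open>e\<close>. The gap is half of
  \<open>(\<bar>x\<bar> - e)\<^sup>2\<close> on the quadratic part and
  \<open>(1 - e) * (\<bar>x\<bar> - (1 + e) / 2)\<close> on the linear part.\<close>

lemma huber_tangent_le:
  assumes "0 \<le> e" "e \<le> 1"
  shows "e * \<bar>x\<bar> - e\<^sup>2 / 2 \<le> huber x"
proof (cases "\<bar>x\<bar> \<le> 1")
  case True
  have "0 \<le> (\<bar>x\<bar> - e)\<^sup>2"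
    by simp
  also have "(\<bar>x\<bar> - e)\<^sup>2 = x\<^sup>2 - 2 * e * \<bar>x\<bar> + e\<^sup>2"
    by (simp add: power2_diff)
  finally show ?thesis
    using True by (auto simp: huber_def)
next
  case False
  have "0 \<le> (1 - e) * (\<bar>x\<bar> - (1 + e) / 2)"
    using assms False by (intro mult_nonneg_nonneg) auto
  then have "e * \<bar>x\<bar> - e\<^sup>2 / 2 \<le> \<bar>x\<bar> - 1 / 2"
    by (simp add: field_simps power2_eq_square)
  then show ?thesis
    using False by (auto simp: huber_def)
qed

lemma huber_ge:
  assumes "0 \<le> e" "e \<le> 1" "e \<le> \<bar>x\<bar>"
  shows "e\<^sup>2 / 2 \<le> huber x"
  using huber_tangent_le[OF assms(1,2), of x] mult_left_mono[OF assms(3,1)]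
  by (simp add: power2_eq_square)

lemma borel_measurable_huber [measurable]: "huber \<in> borel_measurable borel"
  unfolding huber_def [abs_def] by measurable

lemma (in prob_space) integrable_huber_bounded:
  assumes [measurable]: "X \<in> borel_measurable M" and "\<And>\<omega>. \<omega> \<in> space M \<Longrightarrow> \<bar>X \<omega>\<bar> \<le> C"
  shows "integrable M (\<lambda>\<omega>. huber (X \<omega>))"
proof (rule integrable_const_bound[where B = C])
  show "AE \<omega> in M. norm (huber (X \<omega>)) \<le> C"
  proof (rule AE_I2)
    fix \<omega> assume "\<omega> \<in> space M"
    then show "norm (huber (X \<omega>)) \<le> C"
      using huber_nonneg[of "X \<omega>"] huber_le_abs[of "X \<omega>"] assms(2)[of \<omega>] by simp
  qed
qed measurable

section \<open>Almost sure summability and the pathwise convergence argument\<close>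

lemma (in finite_measure) AE_summable_of_summable_integral:
  fixes f :: "nat \<Rightarrow> 'a \<Rightarrow> real"
  assumes int: "\<And>n. integrable M (f n)" and nn: "\<And>n \<omega>. 0 \<le> f n \<omega>"
    and sm: "summable (\<lambda>n. \<integral>\<omega>. f n \<omega> \<partial>M)"
  shows "AE \<omega> in M. summable (\<lambda>n. f n \<omega>)"
proof -
  have [measurable]: "f n \<in> borel_measurable M" for n
    using int by auto
  have "(\<integral>\<^sup>+\<omega>. (\<Sum>n. ennreal (f n \<omega>)) \<partial>M) = (\<Sum>n. \<integral>\<^sup>+\<omega>. ennreal (f n \<omega>) \<partial>M)"
    by (rule nn_integral_suminf) measurable
  also have "\<dots> = (\<Sum>n. ennreal (\<integral>\<omega>. f n \<omega> \<partial>M))"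
    using int nn by (subst nn_integral_eq_integral) auto
  also have "\<dots> = ennreal (\<Sum>n. \<integral>\<omega>. f n \<omega> \<partial>M)"
    using nn sm by (intro suminf_ennreal2) (auto intro: integral_nonneg_AE)
  finally have "(\<integral>\<^sup>+\<omega>. (\<Sum>n. ennreal (f n \<omega>)) \<partial>M) \<noteq> \<infinity>"
    by simp
  then have "AE \<omega> in M. (\<Sum>n. ennreal (f n \<omega>)) \<noteq> \<infinity>"
    by (intro nn_integral_PInf_AE) measurable
  then show ?thesis
    by eventually_elim (auto intro!: summable_suminf_not_top nn)
qed

text \<open>A discrete intermediate value property: the first index from \<open>K\<close> on at
  which \<open>E\<close> reaches \<open>x\<close> overshoots by at most one step. It supplies the
  free endpoint of the blocks below.\<close>

lemma bounded_step_crossing: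
  fixes E :: "nat \<Rightarrow> real"
  assumes step: "\<And>n. E (Suc n) \<le> E n + 1" and lim: "filterlim E at_top sequentially"
    and "E K \<le> x"
  obtains N where "K \<le> N" "x \<le> E N" "E N \<le> x + 1"
proof -
  define N where "N = (LEAST N. K \<le> N \<and> x \<le> E N)"
  have "eventually (\<lambda>N. K \<le> N \<and> x \<le> E N) sequentially"
    using lim by (intro eventually_conj eventually_ge_at_top) (auto simp: filterlim_at_top)
  then have "\<exists>N. K \<le> N \<and> x \<le> E N"
    by (auto simp: eventually_sequentially)
  then have N: "K \<le> N \<and> x \<le> E N"
    unfolding N_def by (rule LeastI_ex)
  have "E N \<le> x + 1"
  proof (cases "N = K")
    case False
    \<comment> \<open>By minimality of \<open>N\<close>, the predecessor still lies below
      \<open>x\<close>.\<close>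
    then obtain L where L: "N = Suc L" "K \<le> L"
      using N by (cases N) auto
    then have "\<not> (K \<le> L \<and> x \<le> E L)"
      unfolding N_def by (intro not_less_Least) (simp add: N_def)
    then show ?thesis
      using L step[of L] by auto
  qed (use assms(3) in auto)
  then show ?thesis
    using N that by auto
qed

text \<open>Every Huber value on the block is at least \<open>e\<^sup>2 / 2\<close>. Enlarging the
  denominators to \<open>E b\<close> makes the weights telescope to
  \<open>(E b - E a) / E b\<close>, which is at least \<open>e / 2\<close>. The product of the two
  bounds is the fixed contribution of a block.\<close>

lemma huber_block_sum_ge:
  fixes E s :: "nat \<Rightarrow> real"
  assumes mono: "incseq E" and pos: "\<And>n. n > a \<Longrightarrow> E n > 0" and "a < b"
    and growth: "e / 2 * E b \<le> E b - E a"
    and far: "\<And>m. a < m \<Longrightarrow> m \<le> b \<Longrightarrow> e \<le> \<bar>s m / E m - 1\<bar>"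
    and e: "0 \<le> e" "e \<le> 1"
  shows "e ^ 3 / 4 \<le> (\<Sum>i=a..<b. (E (Suc i) - E i) / E (Suc i) * huber (s (Suc i) / E (Suc i) - 1))"
proof -
  have Eb: "E b > 0"
    using pos \<open>a < b\<close> by simp
  have "e / 2 \<le> (E b - E a) / E b"
    using growth Eb by (simp add: field_simps)
  then have "e / 2 * (e\<^sup>2 / 2) \<le> (E b - E a) / E b * (e\<^sup>2 / 2)"
    by (intro mult_right_mono) auto
  moreover have "(\<Sum>i=a..<b. E (Suc i) - E i) = E b - E a"
    using \<open>a < b\<close> by (intro sum_Suc_diff') simp
  ultimately have "e ^ 3 / 4 \<le> (\<Sum>i=a..<b. (E (Suc i) - E i) / E b * (e\<^sup>2 / 2))"
    by (simp flip: sum_distrib_right sum_divide_distrib add: power3_eq_cube power2_eq_square)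
  also have "\<dots> \<le> (\<Sum>i=a..<b. (E (Suc i) - E i) / E (Suc i) * huber (s (Suc i) / E (Suc i) - 1))"
  proof (intro sum_mono mult_mono)
    fix i assume i: "i \<in> {a..<b}"
    show "(E (Suc i) - E i) / E b \<le> (E (Suc i) - E i) / E (Suc i)"
      using i pos mono by (intro divide_left_mono) (auto simp: incseq_SucD incseqD Eb)
    show "e\<^sup>2 / 2 \<le> huber (s (Suc i) / E (Suc i) - 1)"
      using i far[of "Suc i"] e by (intro huber_ge) auto
    show "0 \<le> (E (Suc i) - E i) / E (Suc i)"
      using i pos[of "Suc i"] incseq_SucD[OF mono, of i] by simp
  qed simp
  finally show ?thesis .
qed

lemma ratio_tendsto_1_of_summable_huber:
  fixes E s :: "nat \<Rightarrow> real"
  assumes mono: "incseq E" and step: "\<And>n. E (Suc n) \<le> E n + 1"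
    and pos: "\<And>n. n > 0 \<Longrightarrow> E n > 0"
    and lim: "filterlim E at_top sequentially" and smono: "incseq s"
    and sm: "summable (\<lambda>i. (E (Suc i) - E i) / E (Suc i) * huber (s (Suc i) / E (Suc i) - 1))"
  shows "(\<lambda>n. s n / E n) \<longlonglongrightarrow> 1"
proof (rule tendstoI)
  fix r :: real assume "0 < r"
  \<comment> \<open>A deviation of at least \<open>r\<close> is then one of at least
    \<open>4 * e\<close>. The cap 1/4 gives \<open>1 - 2 * e \<ge> 1 / 2\<close> and
    \<open>(1 + e) * (1 + 2 * e) \<le> 1 + 4 * e\<close>, both used below.\<close>
  define e where "e = min (r / 4) (1 / 4)"
  have e: "0 < e" "e \<le> 1 / 4" "4 * e \<le> r"
    using \<open>0 < r\<close> by (auto simp: e_def)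
  let ?t = "\<lambda>i. (E (Suc i) - E i) / E (Suc i) * huber (s (Suc i) / E (Suc i) - 1)"
  have "0 < e ^ 3 / 4"
    using e by simp
  then obtain K where K: "\<And>a b. K \<le> a \<Longrightarrow> norm (sum ?t {a..<b}) < e ^ 3 / 4"
    using sm unfolding summable_Cauchy by blast
  \<comment> \<open>The Cauchy criterion makes block sums beyond \<open>K\<close> smaller than the
    lower bound of \<open>huber_block_sum_ge\<close>.\<close>
  have no_block: False
    if "K \<le> a" "a < b" "e / 2 * E b \<le> E b - E a"
      "\<And>m. a < m \<Longrightarrow> m \<le> b \<Longrightarrow> e \<le> \<bar>s m / E m - 1\<bar>" for a b
    using huber_block_sum_ge[OF mono pos that(2,3,4)] e K[OF that(1), of b] by auto
  \<comment> \<open>The threshold \<open>1 / e\<close> makes an overshoot by 1 cost at most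
    \<open>e * E n\<close>. The threshold \<open>2 * E K\<close> lets a block that ends at
    \<open>n\<close> begin at or after \<open>K\<close>.\<close>
  have "eventually (\<lambda>n. K \<le> n \<and> 1 \<le> n \<and> max (1 / e) (2 * E K) \<le> E n) sequentially"
    using lim by (intro eventually_conj eventually_ge_at_top) (simp add: filterlim_at_top del: max.bounded_iff)
  then show "eventually (\<lambda>n. dist (s n / E n) 1 < r) sequentially"
  proof eventually_elim
    case (elim n)
    then have En: "E n > 0" "1 \<le> e * E n" "2 * E K \<le> E n" and n: "K \<le> n" "0 < n"
      using pos[of n] e by (auto simp: field_simps)
    show ?case
    proof (rule ccontr)
      assume "\<not> ?case"
      then consider "1 + 4 * e \<le> s n / E n" | "s n / E n \<le> 1 - 4 * e"
        using e by (fastforce simp: dist_real_def abs_if split: if_splits)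
      then show False
      proof cases
        \<comment> \<open>Surplus: go forward from \<open>n\<close> until \<open>E\<close> has grown
          by a factor between \<open>1 + e\<close> and \<open>1 + 2 * e\<close>. Since
          \<open>s\<close> does not decrease, its ratio to \<open>E\<close> stays at least
          \<open>1 + e\<close> on the way.\<close>
        case 1
        then have sn: "(1 + 4 * e) * E n \<le> s n"
          using En by (simp add: field_simps)
        have "E n \<le> (1 + e) * E n"
          using e En by (simp add: field_simps)
        then obtain N where N: "n \<le> N" "(1 + e) * E n \<le> E N" "E N \<le> (1 + e) * E n + 1"
          using bounded_step_crossing[OF step lim] by blast
        have EN: "E N \<le> (1 + 2 * e) * E n"
          using N En by (simp add: algebra_simps)
        have "n \<noteq> N"
          using N e En by (auto simp: algebra_simps)
        then have "n < N"
          using N by simp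
        moreover have "e / 2 * E N \<le> E N - E n"
        proof -
          have "e / 2 * E N \<le> e / 2 * ((1 + 2 * e) * E n)"
            using EN e by (intro mult_left_mono) auto
          also have "\<dots> \<le> e / 2 * (2 * E n)"
            using e En by (intro mult_left_mono mult_right_mono) auto
          finally show ?thesis
            using N by (simp add: algebra_simps)
        qed
        moreover have "e \<le> \<bar>s m / E m - 1\<bar>" if "n < m" "m \<le> N" for m
        proof -
          have "(1 + e) * E m \<le> (1 + e) * ((1 + 2 * e) * E n)"
            using EN incseqD[OF mono that(2)] e by (intro mult_left_mono) auto
          also have "\<dots> = ((1 + e) * (1 + 2 * e)) * E n"
            by simp
          also have "\<dots> \<le> (1 + 4 * e) * E n"
          proof (rule mult_right_mono)
            have "e * (2 * e) \<le> e * 1"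
              using e by (intro mult_left_mono) auto
            then show "(1 + e) * (1 + 2 * e) \<le> 1 + 4 * e"
              by (simp add: algebra_simps)
          qed (use En in simp)
          also have "\<dots> \<le> s m"
            using sn incseqD[OF smono, of n m] that by simp
          finally have "1 + e \<le> s m / E m"
            using pos[of m] that by (simp add: field_simps)
          then show ?thesis
            by simp
        qed
        ultimately show False
          using no_block n by blast
      next
        \<comment> \<open>Deficit: go back to an \<open>N\<close> where \<open>E N\<close> lies
          between \<open>1 - 2 * e\<close> and \<open>1 - e\<close> times \<open>E n\<close>. For
          \<open>m\<close> after \<open>N\<close> and up to \<open>n\<close>, \<open>s m\<close> is
          at most \<open>s n\<close>, hence at most \<open>(1 - e) * (1 - 2 * e) * E n\<close>,
          while \<open>E m\<close> is at least \<open>(1 - 2 * e) * E n\<close>.\<close>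
        case 2
        then have sn: "s n \<le> (1 - 4 * e) * E n"
          using En by (simp add: field_simps)
        have "2 * e * E n \<le> 1 / 2 * E n"
          using e En by (intro mult_right_mono) auto
        moreover have "(1 - 2 * e) * E n = E n - 2 * e * E n"
          by (simp add: algebra_simps)
        ultimately have "E K \<le> (1 - 2 * e) * E n"
          using En by linarith
        then obtain N where N: "K \<le> N" "(1 - 2 * e) * E n \<le> E N" "E N \<le> (1 - 2 * e) * E n + 1"
          using bounded_step_crossing[OF step lim] by blast
        have EN: "E N \<le> (1 - e) * E n"
          using N En by (simp add: algebra_simps)
        then have "E N < E n"
          using e En by (smt (verit) mult_less_cancel_right2)
        then have "N < n"
          using incseqD[OF mono, of n N] by (cases "n \<le> N") auto
        moreover have "e / 2 * E n \<le> E n - E N"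
        proof -
          have "e / 2 * E n \<le> e * E n"
            using e En by simp
          then show ?thesis
            using EN by (simp add: algebra_simps)
        qed
        moreover have "e \<le> \<bar>s m / E m - 1\<bar>" if "N < m" "m \<le> n" for m
        proof -
          have "s m \<le> (1 - 4 * e) * E n"
            using sn incseqD[OF smono that(2)] by simp
          also have "\<dots> \<le> ((1 - e) * (1 - 2 * e)) * E n"
            using e En by (intro mult_right_mono) (auto simp: algebra_simps)
          also have "\<dots> = (1 - e) * ((1 - 2 * e) * E n)"
            by simp
          also have "\<dots> \<le> (1 - e) * E m"
            using N incseqD[OF mono, of N m] that e by (intro mult_left_mono) auto
          finally have "s m / E m \<le> 1 - e"
            using pos[of m] that by (simp add: field_simps)
          then show ?thesis
            by simp
        qed
        ultimately show False
          using no_block N by blast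
      qed
    qed
  qed
qed

section \<open>Counts of events and their means\<close>

lemma event_count_0: "event_count B 0 \<omega> = 0"
  by (simp add: event_count_def)

lemma event_count_Suc: "event_count B (Suc n) \<omega> = event_count B n \<omega> + indicator (B (Suc n)) \<omega>"
  by (simp add: event_count_def)

lemma incseq_event_count: "incseq (\<lambda>n. event_count B n \<omega>)"
  by (intro incseq_SucI) (simp add: event_count_Suc)

lemma event_count_bounds: "0 \<le> event_count B n \<omega>" "event_count B n \<omega> \<le> real n"
  by (induction n) (auto simp: event_count_0 event_count_Suc indicator_def)

locale event_seq = prob_space +
  fixes B :: "nat \<Rightarrow> 'a set"
  assumes events: "\<And>k. k > 0 \<Longrightarrow> B k \<in> sets M"
begin

lemma borel_measurable_event_count [measurable]: "event_count B n \<in> borel_measurable M"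
  unfolding event_count_def [abs_def]
  by (intro borel_measurable_sum borel_measurable_indicator events) auto

lemma mean_count_eq: "mean_count M B n = (\<Sum>k=1..n. measure M (B k))"
proof -
  have "(\<integral>\<omega>. indicator (B k) \<omega> \<partial>M) = measure M (B k)" if "k \<in> {1..n}" for k
    using events[of k] that by simp
  moreover have "integrable M (\<lambda>\<omega>. indicator (B k) \<omega> :: real)" if "k \<in> {1..n}" for k
    using events[of k] that by (simp add: integrable_real_indicator emeasure_eq_measure)
  ultimately show ?thesis
    unfolding mean_count_def event_count_def by (subst Bochner_Integration.integral_sum) auto
qed

lemma mean_count_Suc: "mean_count M B (Suc n) = mean_count M B n + measure M (B (Suc n))"
  by (simp add: mean_count_eq)

lemma incseq_mean_count: "incseq (mean_count M B)"
  by (intro incseq_SucI) (simp add: mean_count_Suc)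

lemma mean_count_bounds: "0 \<le> mean_count M B n" "mean_count M B n \<le> real n"
  by (induction n) (use measure_le_1 in \<open>auto simp: mean_count_eq add_mono add.commute\<close>)

lemma mean_count_pos:
  assumes "measure M (B 1) > 0" "n > 0"
  shows "mean_count M B n > 0"
proof -
  have "mean_count M B 1 \<le> mean_count M B n"
    using assms(2) by (intro incseqD[OF incseq_mean_count]) simp
  then show ?thesis
    using assms(1) by (simp add: mean_count_eq)
qed

lemma integrable_huber_event_count:
  "integrable M (\<lambda>\<omega>. huber ((event_count B k \<omega> - mean_count M B k) / c))"
\<comment> \<open>For \<open>c = 0\<close> the bound remains true, both quotients being 0.\<close>
proof (rule integrable_huber_bounded[where C = "real k / \<bar>c\<bar>"])
  fix \<omega>
  have "\<bar>event_count B k \<omega> - mean_count M B k\<bar> \<le> real k"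
    using event_count_bounds[of B k \<omega>] mean_count_bounds[of k] by linarith
  then show "\<bar>(event_count B k \<omega> - mean_count M B k) / c\<bar> \<le> real k / \<bar>c\<bar>"
    by (simp add: divide_right_mono)
qed measurable

text \<open>The means are the partial sums of the probabilities; if they were bounded, the extended
  series would have a finite value.\<close>

lemma mean_count_at_top:
  assumes "divergent_probs M B"
  shows "filterlim (mean_count M B) at_top sequentially"
  unfolding filterlim_at_top
proof
  fix Z
  have "\<exists>N. Z \<le> mean_count M B N"
  proof (rule ccontr)
    assume "\<not> ?thesis"
    then have "\<And>n. (\<Sum>k<n. measure M (B (Suc k))) \<le> Z"
      unfolding mean_count_eq by (simp add: sum.atLeast1_atMost_eq not_le less_imp_le)
    then have "summable (\<lambda>k. measure M (B (Suc k)))"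
      by (intro summableI_nonneg_bounded) auto
    then have "(\<Sum>k. emeasure M (B (Suc k))) = ennreal (\<Sum>k. measure M (B (Suc k)))"
      unfolding emeasure_eq_measure by (intro suminf_ennreal2) auto
    then show False
      using assms by (simp add: divergent_probs_def)
  qed
  then obtain N where "Z \<le> mean_count M B N"
    by blast
  then show "eventually (\<lambda>n. Z \<le> mean_count M B n) sequentially"
    using incseqD[OF incseq_mean_count] by (auto simp: eventually_sequentially intro: order_trans)
qed

section \<open>The three criteria for a sequence of events\<close>

lemma borel_cantelli_seq_of_array:
  assumes meas: "\<And>m j. j \<in> {1..m} \<Longrightarrow> g j m \<in> borel_measurable M"
    and nn: "\<And>m j \<omega>. j \<in> {1..m} \<Longrightarrow> \<omega> \<in> space M \<Longrightarrow> 0 \<le> g j m \<omega>"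
    and le: "\<And>m j \<omega>. j \<in> {1..m} \<Longrightarrow> \<omega> \<in> space M \<Longrightarrow> g j m \<omega> \<le> indicator (B j) \<omega>"
    and at_top: "filterlim (\<lambda>k. mean_array_sum M g (n k)) at_top sequentially"
    and lim: "(\<lambda>k. \<integral>\<omega>. huber ((array_sum g (n k) \<omega> - mean_array_sum M g (n k))
                          / mean_array_sum M g (n k)) \<partial>M) \<longlonglongrightarrow> 0"
  shows "borel_cantelli_seq M B"
proof -
  \<comment> \<open>\<open>A N\<close> is the event that nothing happens after time
    \<open>N\<close>; these events exhaust the complement of the limsup. Starting at
    \<open>Suc N\<close> keeps the dummy \<open>B 0\<close> out.\<close>
  define A where "A N = space M - (\<Union>m\<in>{Suc N..}. B m)" for N
  have A_sets [measurable]: "A N \<in> sets M" for N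
    unfolding A_def by (intro sets.compl_sets sets.countable_UN' events) (auto intro: events)
  let ?S = "array_sum g" and ?E = "mean_array_sum M g"
  have S_meas [measurable]: "?S m \<in> borel_measurable M" for m
    unfolding array_sum_def [abs_def] by (intro borel_measurable_sum meas)
  have S_nonneg: "0 \<le> ?S m \<omega>" if "\<omega> \<in> space M" for m \<omega>
    unfolding array_sum_def using that by (intro sum_nonneg nn) auto
  have S_le: "?S m \<omega> \<le> event_count B m \<omega>" if "\<omega> \<in> space M" for m \<omega>
    unfolding array_sum_def event_count_def using that by (intro sum_mono le) auto
  \<comment> \<open>On \<open>A N\<close> only the first \<open>N\<close> events can contribute,
    which bounds the array sums uniformly in \<open>m\<close>.\<close>
  have S_le_A: "?S m \<omega> \<le> real N" if "\<omega> \<in> A N" for m \<omega> N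
  proof -
    have "event_count B m \<omega> \<le> (\<Sum>k=1..m. indicator {1..N} k)"
      unfolding event_count_def using that
      by (intro sum_mono) (auto simp: A_def indicator_def not_le Suc_le_eq)
    also have "\<dots> = real (card ({1..m} \<inter> {1..N}))"
      using sum.inter_restrict[of "{1..m}" "\<lambda>_. 1 :: real" "{1..N}"]
      by (simp add: indicator_def of_bool_def)
    also have "\<dots> \<le> real N"
      using card_mono[of "{1..N}" "{1..m} \<inter> {1..N}"] by simp
    finally show ?thesis
      using S_le[of \<omega> m] that by (simp add: A_def)
  qed
  have "measure M (A N) = 0" for N
  proof -
    \<comment> \<open>Once the mean is at least \<open>2 * real N\<close>, the sum on
      \<open>A N\<close> is at most half of it, so the normalised deviation is at most -1/2 and its
      Huber value at least 1/8. The bound 1 keeps the divisor positive when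
      \<open>N = 0\<close>.\<close>
    have "eventually (\<lambda>k. max 1 (2 * real N) \<le> ?E (n k)) sequentially"
      using at_top by (simp add: filterlim_at_top del: max.bounded_iff)
    then have "eventually (\<lambda>k. measure M (A N) / 8 \<le>
        (\<integral>\<omega>. huber ((?S (n k) \<omega> - ?E (n k)) / ?E (n k)) \<partial>M)) sequentially"
    proof eventually_elim
      case (elim k)
      let ?X = "\<lambda>\<omega>. (?S (n k) \<omega> - ?E (n k)) / ?E (n k)"
      have E: "1 \<le> ?E (n k)" "2 * real N \<le> ?E (n k)"
        using elim by auto
      have int: "integrable M (\<lambda>\<omega>. huber (?X \<omega>))"
      proof (rule integrable_huber_bounded[where C = "(real (n k) + ?E (n k)) / ?E (n k)"])
        fix \<omega> assume "\<omega> \<in> space M"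
        then have "\<bar>?S (n k) \<omega> - ?E (n k)\<bar> \<le> real (n k) + ?E (n k)"
          using S_nonneg[of \<omega> "n k"] S_le[of \<omega> "n k"] event_count_bounds[of B "n k" \<omega>] E by linarith
        then show "\<bar>?X \<omega>\<bar> \<le> (real (n k) + ?E (n k)) / ?E (n k)"
          using E by (simp add: divide_right_mono)
      qed measurable
      have "measure M (A N) / 8 = (\<integral>\<omega>. indicator (A N) \<omega> / 8 \<partial>M)"
        by simp
      also have "\<dots> \<le> (\<integral>\<omega>. huber (?X \<omega>) \<partial>M)"
      proof (intro integral_mono int)
        show "integrable M (\<lambda>\<omega>. indicator (A N) \<omega> / 8 :: real)"
          by (simp add: integrable_real_indicator emeasure_eq_measure)
        fix \<omega> assume "\<omega> \<in> space M"
        show "indicator (A N) \<omega> / 8 \<le> huber (?X \<omega>)"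
        proof (cases "\<omega> \<in> A N")
          case True
          then have "?X \<omega> \<le> - 1 / 2"
            using S_le_A[of \<omega> N "n k"] E by (simp add: field_simps)
          then have "1 / 2 \<le> \<bar>?X \<omega>\<bar>"
            by linarith
          then have "(1 / 2)\<^sup>2 / 2 \<le> huber (?X \<omega>)"
            by (rule huber_ge[rotated 2]) auto
          then show ?thesis
            using True by (simp add: power2_eq_square)
        qed (simp add: huber_nonneg)
      qed
      finally show ?case .
    qed
    \<comment> \<open>The lower bound does not depend on \<open>k\<close>, so it survives the
      passage to the limit.\<close>
    then have "measure M (A N) / 8 \<le> 0"
      by (intro tendsto_lowerbound[OF lim]) auto
    then show ?thesis
      using measure_nonneg[of M "A N"] by linarith
  qed
  then have "(\<Union>N. A N) \<in> null_sets M"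
    by (intro null_sets_UN') (auto simp: null_sets_def emeasure_eq_measure)
  moreover have "limsup B = space M - (\<Union>N. A N)"
  proof -
    \<comment> \<open>Shifting the tails from \<open>N\<close> to \<open>Suc N\<close> leaves their
      intersection unchanged.\<close>
    have "\<omega> \<in> limsup B \<longleftrightarrow> (\<forall>N. \<exists>m\<ge>Suc N. \<omega> \<in> B m)" for \<omega>
      unfolding limsup_INF_SUP by (auto dest: Suc_leD)
    moreover have "\<omega> \<in> space M" if "m \<ge> Suc N" "\<omega> \<in> B m" for \<omega> m N
      using events[of m] sets.sets_into_space that by fastforce
    ultimately show ?thesis
      unfolding A_def by (fastforce simp: set_eq_iff)
  qed
  ultimately show ?thesis
    unfolding borel_cantelli_seq_def
    by (simp add: prob_compl null_setsD2 measure_eq_0_null_sets)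
qed

lemma L1_borel_cantelli_seq_of_huber:
  assumes pos: "measure M (B 1) > 0" and div: "divergent_probs M B"
    and lim: "(\<lambda>n. \<integral>\<omega>. huber ((event_count B n \<omega> - mean_count M B n) / mean_count M B n) \<partial>M) \<longlonglongrightarrow> 0"
  shows "L1_borel_cantelli_seq M B"
  unfolding L1_borel_cantelli_seq_def
proof (intro conjI div tendstoI)
  let ?H = "\<lambda>n. \<integral>\<omega>. huber ((event_count B n \<omega> - mean_count M B n) / mean_count M B n) \<partial>M"
  let ?L = "\<lambda>n. \<integral>\<omega>. \<bar>event_count B n \<omega> / mean_count M B n - 1\<bar> \<partial>M"
  fix r :: real assume "0 < r"
  define e where "e = min r 1"
  have e: "0 < e" "e \<le> 1" "e \<le> r"
    using \<open>0 < r\<close> by (auto simp: e_def)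
  \<comment> \<open>The tangent bound divided by \<open>e\<close> gives
    \<open>?L n \<le> ?H n / e + e / 2\<close>, so this threshold yields
    \<open>?L n < e\<close>.\<close>
  have "eventually (\<lambda>n. ?H n < e\<^sup>2 / 2) sequentially"
    using e by (intro order_tendstoD[OF lim]) simp
  then show "eventually (\<lambda>n. dist (?L n) 0 < r) sequentially"
    using eventually_gt_at_top[of 0]
  proof eventually_elim
    case (elim n)
    have E: "mean_count M B n > 0"
      using mean_count_pos[OF pos] elim by simp
    have "?L n \<le> (\<integral>\<omega>. huber ((event_count B n \<omega> - mean_count M B n) / mean_count M B n) / e + e / 2 \<partial>M)"
    \<comment> \<open>This rule asks for integrability of the majorant only; the nonnegativity of
      the majorant covers the default value 0 of the integral on the left.\<close>
    proof (rule integral_mono')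
      show "integrable M (\<lambda>\<omega>. huber ((event_count B n \<omega> - mean_count M B n) / mean_count M B n) / e + e / 2)"
        using integrable_huber_event_count by simp
      fix \<omega>
      have "event_count B n \<omega> / mean_count M B n - 1 = (event_count B n \<omega> - mean_count M B n) / mean_count M B n"
        using E by (simp add: field_simps)
      then show "\<bar>event_count B n \<omega> / mean_count M B n - 1\<bar>
          \<le> huber ((event_count B n \<omega> - mean_count M B n) / mean_count M B n) / e + e / 2"
        using huber_tangent_le[of e "event_count B n \<omega> / mean_count M B n - 1"] e
        by (simp add: field_simps power2_eq_square)
      then show "0 \<le> huber ((event_count B n \<omega> - mean_count M B n) / mean_count M B n) / e + e / 2"
        by linarith
    qed
    also have "\<dots> = ?H n / e + e / 2"
      using integrable_huber_event_count by (simp add: prob_space)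
    also have "\<dots> < e"
      using elim e by (simp add: field_simps power2_eq_square)
    finally show ?case
      using e by simp
  qed
qed

lemma strongly_borel_cantelli_seq_of_huber:
  assumes pos: "measure M (B 1) > 0" and div: "divergent_probs M B"
    and sm: "summable (\<lambda>i. measure M (B (Suc i)) / mean_count M B (Suc i) *
      (\<integral>\<omega>. huber ((event_count B (Suc i) \<omega> - mean_count M B (Suc i)) / mean_count M B (Suc i)) \<partial>M))"
  shows "strongly_borel_cantelli_seq M B"
proof -
  let ?E = "mean_count M B"
  let ?f = "\<lambda>i \<omega>. measure M (B (Suc i)) / ?E (Suc i) *
      huber ((event_count B (Suc i) \<omega> - ?E (Suc i)) / ?E (Suc i))"
  have "AE \<omega> in M. summable (\<lambda>i. ?f i \<omega>)"
  proof (rule AE_summable_of_summable_integral)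
    show "integrable M (?f i)" for i
      using integrable_huber_event_count by (intro integrable_mult_right) simp
    show "0 \<le> ?f i \<omega>" for i \<omega>
      by (intro mult_nonneg_nonneg divide_nonneg_nonneg huber_nonneg mean_count_bounds) simp
    show "summable (\<lambda>i. \<integral>\<omega>. ?f i \<omega> \<partial>M)"
      using sm by simp
  qed
  then have "AE \<omega> in M. (\<lambda>n. event_count B n \<omega> / ?E n) \<longlonglongrightarrow> 1"
  proof eventually_elim
    case (elim \<omega>)
    \<comment> \<open>Each probability is an increment of the mean count, which gives the series the
      form required by the pathwise lemma.\<close>
    have "?f i \<omega> = (?E (Suc i) - ?E i) / ?E (Suc i) * huber (event_count B (Suc i) \<omega> / ?E (Suc i) - 1)" for i
      using mean_count_pos[OF pos, of "Suc i"] by (simp add: diff_divide_distrib mean_count_Suc)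
    then have "summable (\<lambda>i. (?E (Suc i) - ?E i) / ?E (Suc i) * huber (event_count B (Suc i) \<omega> / ?E (Suc i) - 1))"
      using elim by (simp only:)
    then show ?case
      by (intro ratio_tendsto_1_of_summable_huber incseq_mean_count incseq_event_count
            mean_count_at_top[OF div] mean_count_pos[OF pos]) (simp_all add: mean_count_Suc)
  qed
  with div show ?thesis
    by (simp add: strongly_borel_cantelli_seq_def)
qed

end

theorem proposition2p3:
  fixes M :: "'a measure" and B :: "nat \<Rightarrow> 'a set"
  assumes "prob_space M"
    and "\<And>k. k > 0 \<Longrightarrow> B k \<in> sets M"
    and "measure M (B 1) > 0"
    and "divergent_probs M B"
  shows
    "((\<exists>(g :: nat \<Rightarrow> nat \<Rightarrow> 'a \<Rightarrow> real) (n :: nat \<Rightarrow> nat).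
         (\<forall>m. \<forall>j\<in>{1..m}. g j m \<in> borel_measurable M \<and>
            (\<forall>\<omega>\<in>space M. 0 \<le> g j m \<omega> \<and> g j m \<omega> \<le> indicator (B j) \<omega>)) \<and>
         strict_mono n \<and> (\<forall>k. n k > 0) \<and>
         filterlim (\<lambda>k. mean_array_sum M g (n k)) at_top sequentially \<and>
         (\<lambda>k. \<integral>\<omega>. huber ((array_sum g (n k) \<omega> - mean_array_sum M g (n k))
                          / mean_array_sum M g (n k)) \<partial>M) \<longlonglongrightarrow> 0)
       \<longrightarrow> borel_cantelli_seq M B)
   \<and> ((\<lambda>n. \<integral>\<omega>. huber ((event_count B n \<omega> - mean_count M B n) / mean_count M B n) \<partial>M) \<longlonglongrightarrow> 0
       \<longrightarrow> L1_borel_cantelli_seq M B)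
   \<and> (summable (\<lambda>i. let n = Suc i in
          measure M (B n) / mean_count M B n *
          (SUP k\<in>{1..n}. \<integral>\<omega>. huber ((event_count B k \<omega> - mean_count M B k) / mean_count M B n) \<partial>M))
       \<longrightarrow> strongly_borel_cantelli_seq M B)"
proof -
  interpret event_seq M B
    using assms(1,2) by (simp add: event_seq_def event_seq_axioms_def)
  let ?E = "mean_count M B"
  let ?H = "\<lambda>k c. \<integral>\<omega>. huber ((event_count B k \<omega> - ?E k) / c) \<partial>M"
  have "strongly_borel_cantelli_seq M B"
    if sm: "summable (\<lambda>i. let n = Suc i in measure M (B n) / ?E n * (SUP k\<in>{1..n}. ?H k (?E n)))"
  proof (rule strongly_borel_cantelli_seq_of_huber[OF assms(3,4)], rule summable_comparison_test'[OF sm])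
    fix i
    \<comment> \<open>The diagonal term \<open>k = n\<close> of the supremum. A real supremum needs
      an upper bound, which exists here because the index set is finite.\<close>
    have H_le: "?H (Suc i) (?E (Suc i)) \<le> (SUP k\<in>{1..Suc i}. ?H k (?E (Suc i)))"
      by (intro cSUP_upper) auto
    have H_nonneg: "0 \<le> ?H (Suc i) (?E (Suc i))"
      by (intro integral_nonneg_AE) (simp add: huber_nonneg)
    have "0 \<le> measure M (B (Suc i)) / ?E (Suc i)"
      by (intro divide_nonneg_nonneg mean_count_bounds) simp
    then show "norm (measure M (B (Suc i)) / ?E (Suc i) * ?H (Suc i) (?E (Suc i)))
        \<le> (let n = Suc i in measure M (B n) / ?E n * (SUP k\<in>{1..n}. ?H k (?E n)))"
      using H_le H_nonneg
      by (simp only: Let_def real_norm_def abs_of_nonneg mult_nonneg_nonneg) (rule mult_left_mono)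
  qed
  moreover have "borel_cantelli_seq M B" if "\<exists>(g :: nat \<Rightarrow> nat \<Rightarrow> 'a \<Rightarrow> real) (n :: nat \<Rightarrow> nat).
         (\<forall>m. \<forall>j\<in>{1..m}. g j m \<in> borel_measurable M \<and>
            (\<forall>\<omega>\<in>space M. 0 \<le> g j m \<omega> \<and> g j m \<omega> \<le> indicator (B j) \<omega>)) \<and>
         strict_mono n \<and> (\<forall>k. n k > 0) \<and>
         filterlim (\<lambda>k. mean_array_sum M g (n k)) at_top sequentially \<and>
         (\<lambda>k. \<integral>\<omega>. huber ((array_sum g (n k) \<omega> - mean_array_sum M g (n k))
                          / mean_array_sum M g (n k)) \<partial>M) \<longlonglongrightarrow> 0"
  proof -
    from that obtain g :: "nat \<Rightarrow> nat \<Rightarrow> 'a \<Rightarrow> real" and n :: "nat \<Rightarrow> nat" where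
      g: "\<forall>m. \<forall>j\<in>{1..m}. g j m \<in> borel_measurable M \<and>
            (\<forall>\<omega>\<in>space M. 0 \<le> g j m \<omega> \<and> g j m \<omega> \<le> indicator (B j) \<omega>)" and
      lim: "filterlim (\<lambda>k. mean_array_sum M g (n k)) at_top sequentially"
        "(\<lambda>k. \<integral>\<omega>. huber ((array_sum g (n k) \<omega> - mean_array_sum M g (n k))
                          / mean_array_sum M g (n k)) \<partial>M) \<longlonglongrightarrow> 0"
      by blast
    show ?thesis
      by (rule borel_cantelli_seq_of_array[OF _ _ _ lim]) (use g in blast)+
  qed
  ultimately show ?thesis
    using L1_borel_cantelli_seq_of_huber[OF assms(3,4)] by blast
qed

end
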